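(* Let $(\mathcal R,\otimes,I)$ be a 2-rig with a derivation $\partial:\mathcal R\to\mathcal R$, and let $M$ be an internal semigroup (resp., monoid) in $\mathcal R$, with multiplication $m:M\otimes M\to M$ (and unit $e:I\to M$). Then the map $\partial m:\partial M\otimes M+M\otimes\partial M\to\partial M$ amounts to a pair of actions $i_R:\partial M\otimes M\to\partial M$ and $i_L:M\otimes\partial M\to\partial M$ of $M$ on its derivative object $\partial M$ (respectively a right and a left action).
   Context: A 2-rig is a monoidal category $(\mathcal R,\otimes,I)$ with finite coproducts (written $+$, initial object $0$) such that $\otimes$ preserves finite coproducts in each variable separately. A derivation on $\mathcal R$ is a finite-coproduct-preserving functor $\partial:\mathcal R\to\mathcal R$ equipped with a left strength $R\otimes\partial C\to\partial(R\otimes C)$ and a right strength $\partial C\otimes R\to\partial(C\otimes R)$, natural in both variables, satisfying the usual unit and associativity axioms for tensorial strengths and compatible with each other (a bimodule morphism from $\mathcal R$, acting on itself on both sides by $\otimes$, to itself), such that the induced map $\mathfrak l:\partial C\otimes C'+C\otimes\partial C'\to\partial(C\otimes C')$ (the leibnizator) and the map $0\to\partial(I)$ are isomorphisms. In the statement, $\partial m$ is regarded as a map out of $\partial M\otimes M+M\otimes\partial M$ by precomposing $\partial(m):\partial(M\otimes M)\to\partial M$ with the isomorphism $\mathfrak l$; $i_R$ and $i_L$ are its restrictions to the two summands. *)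

theory Defs
  imports Main
begin

section \<open>Categories, functors and finite coproducts\<close>

text \<open>
  Composition is written in the usual (right-to-left) order.  Operations are total functions;
  they carry meaning only on objects, on arrows and, for \<open>Comp\<close>, on composable pairs.
\<close>

record ('o, 'm) category =
  Ob :: "'o set"
  Ar :: "'m set"
  Dom :: "'m \<Rightarrow> 'o"
  Cod :: "'m \<Rightarrow> 'o"
  Ident :: "'o \<Rightarrow> 'm" (\<open>\<one>\<index>\<close>)
  Comp :: "'m \<Rightarrow> 'm \<Rightarrow> 'm" (infixr \<open>\<cdot>\<index>\<close> 55)

definition hom :: "('o, 'm, 'b) category_scheme \<Rightarrow> 'o \<Rightarrow> 'o \<Rightarrow> 'm set" (\<open>hom\<index>\<close>) where
  "hom\<^bsub>C\<^esub> a b = {f \<in> Ar C. Dom C f = a \<and> Cod C f = b}"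

locale category =
  fixes C :: "('o, 'm, 'b) category_scheme" (structure)
  assumes Dom_in_Ob: "f \<in> Ar C \<Longrightarrow> Dom C f \<in> Ob C"
    and Cod_in_Ob: "f \<in> Ar C \<Longrightarrow> Cod C f \<in> Ob C"
    and Id_in_hom: "a \<in> Ob C \<Longrightarrow> \<one> a \<in> hom a a"
    and Comp_in_hom: "f \<in> hom a b \<Longrightarrow> g \<in> hom b c \<Longrightarrow> g \<cdot> f \<in> hom a c"
    and Comp_assoc: "f \<in> hom a b \<Longrightarrow> g \<in> hom b c \<Longrightarrow> h \<in> hom c d \<Longrightarrow> (h \<cdot> g) \<cdot> f = h \<cdot> (g \<cdot> f)"
    and Id_left: "f \<in> hom a b \<Longrightarrow> \<one> b \<cdot> f = f"
    and Id_right: "f \<in> hom a b \<Longrightarrow> f \<cdot> \<one> a = f"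

definition isomorphism :: "('o, 'm, 'b) category_scheme \<Rightarrow> 'm \<Rightarrow> bool" where
  "isomorphism C f \<longleftrightarrow> f \<in> Ar C \<and>
     (\<exists>g \<in> hom\<^bsub>C\<^esub> (Cod C f) (Dom C f).
        g \<cdot>\<^bsub>C\<^esub> f = \<one>\<^bsub>C\<^esub> (Dom C f) \<and> f \<cdot>\<^bsub>C\<^esub> g = \<one>\<^bsub>C\<^esub> (Cod C f))"

definition initial_object :: "('o, 'm, 'b) category_scheme \<Rightarrow> 'o \<Rightarrow> bool" where
  "initial_object C z \<longleftrightarrow> z \<in> Ob C \<and> (\<forall>a \<in> Ob C. \<exists>!f. f \<in> hom\<^bsub>C\<^esub> z a)"

definition is_coproduct ::
  "('o, 'm, 'b) category_scheme \<Rightarrow> 'o \<Rightarrow> 'o \<Rightarrow> 'o \<Rightarrow> 'm \<Rightarrow> 'm \<Rightarrow> bool" where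
  "is_coproduct C a b p i j \<longleftrightarrow> i \<in> hom\<^bsub>C\<^esub> a p \<and> j \<in> hom\<^bsub>C\<^esub> b p \<and>
     (\<forall>x f g. f \<in> hom\<^bsub>C\<^esub> a x \<longrightarrow> g \<in> hom\<^bsub>C\<^esub> b x \<longrightarrow>
        (\<exists>!h. h \<in> hom\<^bsub>C\<^esub> p x \<and> h \<cdot>\<^bsub>C\<^esub> i = f \<and> h \<cdot>\<^bsub>C\<^esub> j = g))"

locale cat_functor = A: category A + B: category B
  for A :: "('o1, 'm1, 'b1) category_scheme" and B :: "('o2, 'm2, 'b2) category_scheme"
    and Fo :: "'o1 \<Rightarrow> 'o2" and Fm :: "'m1 \<Rightarrow> 'm2" +
  assumes Fo_in_Ob: "a \<in> Ob A \<Longrightarrow> Fo a \<in> Ob B"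
    and Fm_in_hom: "f \<in> hom\<^bsub>A\<^esub> a b \<Longrightarrow> Fm f \<in> hom\<^bsub>B\<^esub> (Fo a) (Fo b)"
    and Fm_Id: "a \<in> Ob A \<Longrightarrow> Fm (\<one>\<^bsub>A\<^esub> a) = \<one>\<^bsub>B\<^esub> (Fo a)"
    and Fm_Comp: "f \<in> hom\<^bsub>A\<^esub> a b \<Longrightarrow> g \<in> hom\<^bsub>A\<^esub> b c \<Longrightarrow> Fm (g \<cdot>\<^bsub>A\<^esub> f) = Fm g \<cdot>\<^bsub>B\<^esub> Fm f"

definition preserves_finite_coproducts ::
  "('o1, 'm1, 'b1) category_scheme \<Rightarrow> ('o2, 'm2, 'b2) category_scheme \<Rightarrow>
     ('o1 \<Rightarrow> 'o2) \<Rightarrow> ('m1 \<Rightarrow> 'm2) \<Rightarrow> bool" where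
  "preserves_finite_coproducts A B Fo Fm \<longleftrightarrow>
     (\<forall>z. initial_object A z \<longrightarrow> initial_object B (Fo z)) \<and>
     (\<forall>a b p i j. is_coproduct A a b p i j \<longrightarrow>
        is_coproduct B (Fo a) (Fo b) (Fo p) (Fm i) (Fm j))"

definition product_category ::
  "('o1, 'm1, 'b1) category_scheme \<Rightarrow> ('o2, 'm2, 'b2) category_scheme \<Rightarrow>
     ('o1 \<times> 'o2, 'm1 \<times> 'm2) category" where
  "product_category A B =
     \<lparr> Ob = Ob A \<times> Ob B, Ar = Ar A \<times> Ar B,
       Dom = (\<lambda>(f, g). (Dom A f, Dom B g)), Cod = (\<lambda>(f, g). (Cod A f, Cod B g)),
       Ident = (\<lambda>(a, b). (\<one>\<^bsub>A\<^esub> a, \<one>\<^bsub>B\<^esub> b)),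
       Comp = (\<lambda>(g, g') (f, f'). (g \<cdot>\<^bsub>A\<^esub> f, g' \<cdot>\<^bsub>B\<^esub> f')) \<rparr>"


section \<open>Monoidal categories and 2-rigs\<close>

text \<open>The tensor is \<open>\<otimes>\<close> on objects and \<open>\<odot>\<close> on arrows.\<close>

record ('o, 'm) monoidal_category = "('o, 'm) category" +
  Tensor_Ob :: "'o \<Rightarrow> 'o \<Rightarrow> 'o" (infixr \<open>\<otimes>\<index>\<close> 70)
  Tensor_Ar :: "'m \<Rightarrow> 'm \<Rightarrow> 'm" (infixr \<open>\<odot>\<index>\<close> 70)
  Unit_Ob :: 'o (\<open>\<I>\<index>\<close>)
  Assoc :: "'o \<Rightarrow> 'o \<Rightarrow> 'o \<Rightarrow> 'm" (\<open>\<alpha>\<index>\<close>)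
  LUnit :: "'o \<Rightarrow> 'm" (\<open>\<ll>\<index>\<close>)
  RUnit :: "'o \<Rightarrow> 'm" (\<open>\<rho>\<index>\<close>)

locale monoidal_category = category C
  for C :: "('o, 'm, 'b) monoidal_category_scheme" (structure) +
  assumes tensor_functor:
      "cat_functor (product_category C C) C (\<lambda>(a, b). a \<otimes> b) (\<lambda>(f, g). f \<odot> g)"
    and Unit_in_Ob: "\<I> \<in> Ob C"
    and Assoc_in_hom: "a \<in> Ob C \<Longrightarrow> b \<in> Ob C \<Longrightarrow> c \<in> Ob C \<Longrightarrow>
      \<alpha> a b c \<in> hom ((a \<otimes> b) \<otimes> c) (a \<otimes> (b \<otimes> c))"
    and LUnit_in_hom: "a \<in> Ob C \<Longrightarrow> \<ll> a \<in> hom (\<I> \<otimes> a) a"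
    and RUnit_in_hom: "a \<in> Ob C \<Longrightarrow> \<rho> a \<in> hom (a \<otimes> \<I>) a"
    and Assoc_iso: "a \<in> Ob C \<Longrightarrow> b \<in> Ob C \<Longrightarrow> c \<in> Ob C \<Longrightarrow> isomorphism C (\<alpha> a b c)"
    and LUnit_iso: "a \<in> Ob C \<Longrightarrow> isomorphism C (\<ll> a)"
    and RUnit_iso: "a \<in> Ob C \<Longrightarrow> isomorphism C (\<rho> a)"
    and Assoc_natural: "f \<in> hom a a' \<Longrightarrow> g \<in> hom b b' \<Longrightarrow> h \<in> hom c c' \<Longrightarrow>
      \<alpha> a' b' c' \<cdot> ((f \<odot> g) \<odot> h) = (f \<odot> (g \<odot> h)) \<cdot> \<alpha> a b c"
    and LUnit_natural: "f \<in> hom a b \<Longrightarrow> \<ll> b \<cdot> (\<one> \<I> \<odot> f) = f \<cdot> \<ll> a"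
    and RUnit_natural: "f \<in> hom a b \<Longrightarrow> \<rho> b \<cdot> (f \<odot> \<one> \<I>) = f \<cdot> \<rho> a"
    and pentagon: "a \<in> Ob C \<Longrightarrow> b \<in> Ob C \<Longrightarrow> c \<in> Ob C \<Longrightarrow> d \<in> Ob C \<Longrightarrow>
      (\<one> a \<odot> \<alpha> b c d) \<cdot> \<alpha> a (b \<otimes> c) d \<cdot> (\<alpha> a b c \<odot> \<one> d) =
      \<alpha> a b (c \<otimes> d) \<cdot> \<alpha> (a \<otimes> b) c d"
    and triangle: "a \<in> Ob C \<Longrightarrow> b \<in> Ob C \<Longrightarrow>
      (\<one> a \<odot> \<ll> b) \<cdot> \<alpha> a \<I> b = \<rho> a \<odot> \<one> b"

record ('o, 'm) two_rig = "('o, 'm) monoidal_category" +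
  Sum_Ob :: "'o \<Rightarrow> 'o \<Rightarrow> 'o" (infixr \<open>\<oplus>\<index>\<close> 65)
  Inl_Ar :: "'o \<Rightarrow> 'o \<Rightarrow> 'm" (\<open>\<iota>\<^sub>1\<index>\<close>)
  Inr_Ar :: "'o \<Rightarrow> 'o \<Rightarrow> 'm" (\<open>\<iota>\<^sub>2\<index>\<close>)
  Zero_Ob :: 'o (\<open>\<zero>\<index>\<close>)

locale two_rig = monoidal_category R
  for R :: "('o, 'm, 'b) two_rig_scheme" (structure) +
  assumes Zero_initial: "initial_object R \<zero>"
    and Sum_coproduct: "a \<in> Ob R \<Longrightarrow> b \<in> Ob R \<Longrightarrow>
      is_coproduct R a b (a \<oplus> b) (\<iota>\<^sub>1 a b) (\<iota>\<^sub>2 a b)"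
    and tensor_left_preserves: "a \<in> Ob R \<Longrightarrow>
      preserves_finite_coproducts R R (\<lambda>x. a \<otimes> x) (\<lambda>f. \<one> a \<odot> f)"
    and tensor_right_preserves: "a \<in> Ob R \<Longrightarrow>
      preserves_finite_coproducts R R (\<lambda>x. x \<otimes> a) (\<lambda>f. f \<odot> \<one> a)"

definition zero_map :: "('o, 'm, 'b) two_rig_scheme \<Rightarrow> 'o \<Rightarrow> 'm" where
  "zero_map R a = (THE f. f \<in> hom\<^bsub>R\<^esub> \<zero>\<^bsub>R\<^esub> a)"

text \<open>\<open>copair R f g\<close> is the arrow \<open>[f, g] : Dom f + Dom g \<rightarrow> x\<close>, for \<open>f\<close> and \<open>g\<close> with common codomain \<open>x\<close>.\<close>

definition copair :: "('o, 'm, 'b) two_rig_scheme \<Rightarrow> 'm \<Rightarrow> 'm \<Rightarrow> 'm" where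
  "copair R f g =
     (THE h. h \<in> hom\<^bsub>R\<^esub> (Dom R f \<oplus>\<^bsub>R\<^esub> Dom R g) (Cod R f) \<and>
        h \<cdot>\<^bsub>R\<^esub> \<iota>\<^sub>1\<^bsub>R\<^esub> (Dom R f) (Dom R g) = f \<and> h \<cdot>\<^bsub>R\<^esub> \<iota>\<^sub>2\<^bsub>R\<^esub> (Dom R f) (Dom R g) = g)"


section \<open>Derivations\<close>

text \<open>
  \<open>LStr D a c : a \<otimes> \<partial>c \<rightarrow> \<partial>(a \<otimes> c)\<close> is the left strength and
  \<open>RStr D c a : \<partial>c \<otimes> a \<rightarrow> \<partial>(c \<otimes> a)\<close> the right strength.
\<close>

record ('o, 'm) derivation =
  DOb :: "'o \<Rightarrow> 'o"
  DAr :: "'m \<Rightarrow> 'm"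
  LStr :: "'o \<Rightarrow> 'o \<Rightarrow> 'm"
  RStr :: "'o \<Rightarrow> 'o \<Rightarrow> 'm"

definition leibnizator ::
  "('o, 'm, 'b) two_rig_scheme \<Rightarrow> ('o, 'm, 'd) derivation_scheme \<Rightarrow> 'o \<Rightarrow> 'o \<Rightarrow> 'm" where
  "leibnizator R D c c' = copair R (RStr D c c') (LStr D c c')"

locale derivation = two_rig R + cat_functor R R "DOb D" "DAr D"
  for R :: "('o, 'm, 'b) two_rig_scheme" (structure)
    and D :: "('o, 'm, 'd) derivation_scheme" +
  assumes D_preserves: "preserves_finite_coproducts R R (DOb D) (DAr D)"
    and LStr_in_hom: "a \<in> Ob R \<Longrightarrow> c \<in> Ob R \<Longrightarrow>
      LStr D a c \<in> hom (a \<otimes> DOb D c) (DOb D (a \<otimes> c))"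
    and RStr_in_hom: "c \<in> Ob R \<Longrightarrow> a \<in> Ob R \<Longrightarrow>
      RStr D c a \<in> hom (DOb D c \<otimes> a) (DOb D (c \<otimes> a))"
    and LStr_natural: "f \<in> hom a a' \<Longrightarrow> g \<in> hom c c' \<Longrightarrow>
      DAr D (f \<odot> g) \<cdot> LStr D a c = LStr D a' c' \<cdot> (f \<odot> DAr D g)"
    and RStr_natural: "g \<in> hom c c' \<Longrightarrow> f \<in> hom a a' \<Longrightarrow>
      DAr D (g \<odot> f) \<cdot> RStr D c a = RStr D c' a' \<cdot> (DAr D g \<odot> f)"
    and LStr_unit: "c \<in> Ob R \<Longrightarrow> DAr D (\<ll> c) \<cdot> LStr D \<I> c = \<ll> (DOb D c)"
    and RStr_unit: "c \<in> Ob R \<Longrightarrow> DAr D (\<rho> c) \<cdot> RStr D c \<I> = \<rho> (DOb D c)"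
    and LStr_assoc: "a \<in> Ob R \<Longrightarrow> b \<in> Ob R \<Longrightarrow> c \<in> Ob R \<Longrightarrow>
      DAr D (\<alpha> a b c) \<cdot> LStr D (a \<otimes> b) c =
      LStr D a (b \<otimes> c) \<cdot> (\<one> a \<odot> LStr D b c) \<cdot> \<alpha> a b (DOb D c)"
    and RStr_assoc: "c \<in> Ob R \<Longrightarrow> a \<in> Ob R \<Longrightarrow> b \<in> Ob R \<Longrightarrow>
      DAr D (\<alpha> c a b) \<cdot> RStr D (c \<otimes> a) b \<cdot> (RStr D c a \<odot> \<one> b) =
      RStr D c (a \<otimes> b) \<cdot> \<alpha> (DOb D c) a b"
    and strengths_compatible: "a \<in> Ob R \<Longrightarrow> c \<in> Ob R \<Longrightarrow> b \<in> Ob R \<Longrightarrow>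
      DAr D (\<alpha> a c b) \<cdot> RStr D (a \<otimes> c) b \<cdot> (LStr D a c \<odot> \<one> b) =
      LStr D a (c \<otimes> b) \<cdot> (\<one> a \<odot> RStr D c b) \<cdot> \<alpha> a (DOb D c) b"
    and leibnizator_iso: "c \<in> Ob R \<Longrightarrow> c' \<in> Ob R \<Longrightarrow> isomorphism R (leibnizator R D c c')"
    and zero_map_iso: "isomorphism R (zero_map R (DOb D \<I>))"


section \<open>Internal semigroups and monoids, and their actions\<close>

definition internal_semigroup ::
  "('o, 'm, 'b) monoidal_category_scheme \<Rightarrow> 'o \<Rightarrow> 'm \<Rightarrow> bool" where
  "internal_semigroup C M m \<longleftrightarrow> M \<in> Ob C \<and> m \<in> hom\<^bsub>C\<^esub> (M \<otimes>\<^bsub>C\<^esub> M) M \<and>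
     m \<cdot>\<^bsub>C\<^esub> (m \<odot>\<^bsub>C\<^esub> \<one>\<^bsub>C\<^esub> M) = m \<cdot>\<^bsub>C\<^esub> (\<one>\<^bsub>C\<^esub> M \<odot>\<^bsub>C\<^esub> m) \<cdot>\<^bsub>C\<^esub> \<alpha>\<^bsub>C\<^esub> M M M"

definition internal_monoid ::
  "('o, 'm, 'b) monoidal_category_scheme \<Rightarrow> 'o \<Rightarrow> 'm \<Rightarrow> 'm \<Rightarrow> bool" where
  "internal_monoid C M m e \<longleftrightarrow> internal_semigroup C M m \<and> e \<in> hom\<^bsub>C\<^esub> \<I>\<^bsub>C\<^esub> M \<and>
     m \<cdot>\<^bsub>C\<^esub> (e \<odot>\<^bsub>C\<^esub> \<one>\<^bsub>C\<^esub> M) = \<ll>\<^bsub>C\<^esub> M \<and> m \<cdot>\<^bsub>C\<^esub> (\<one>\<^bsub>C\<^esub> M \<odot>\<^bsub>C\<^esub> e) = \<rho>\<^bsub>C\<^esub> M"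

definition right_semigroup_action ::
  "('o, 'm, 'b) monoidal_category_scheme \<Rightarrow> 'o \<Rightarrow> 'm \<Rightarrow> 'o \<Rightarrow> 'm \<Rightarrow> bool" where
  "right_semigroup_action C M m X r \<longleftrightarrow> X \<in> Ob C \<and> r \<in> hom\<^bsub>C\<^esub> (X \<otimes>\<^bsub>C\<^esub> M) X \<and>
     r \<cdot>\<^bsub>C\<^esub> (r \<odot>\<^bsub>C\<^esub> \<one>\<^bsub>C\<^esub> M) = r \<cdot>\<^bsub>C\<^esub> (\<one>\<^bsub>C\<^esub> X \<odot>\<^bsub>C\<^esub> m) \<cdot>\<^bsub>C\<^esub> \<alpha>\<^bsub>C\<^esub> X M M"

definition left_semigroup_action ::
  "('o, 'm, 'b) monoidal_category_scheme \<Rightarrow> 'o \<Rightarrow> 'm \<Rightarrow> 'o \<Rightarrow> 'm \<Rightarrow> bool" where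
  "left_semigroup_action C M m X l \<longleftrightarrow> X \<in> Ob C \<and> l \<in> hom\<^bsub>C\<^esub> (M \<otimes>\<^bsub>C\<^esub> X) X \<and>
     l \<cdot>\<^bsub>C\<^esub> (m \<odot>\<^bsub>C\<^esub> \<one>\<^bsub>C\<^esub> X) = l \<cdot>\<^bsub>C\<^esub> (\<one>\<^bsub>C\<^esub> M \<odot>\<^bsub>C\<^esub> l) \<cdot>\<^bsub>C\<^esub> \<alpha>\<^bsub>C\<^esub> M M X"

definition right_monoid_action ::
  "('o, 'm, 'b) monoidal_category_scheme \<Rightarrow> 'o \<Rightarrow> 'm \<Rightarrow> 'm \<Rightarrow> 'o \<Rightarrow> 'm \<Rightarrow> bool" where
  "right_monoid_action C M m e X r \<longleftrightarrow> right_semigroup_action C M m X r \<and>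
     r \<cdot>\<^bsub>C\<^esub> (\<one>\<^bsub>C\<^esub> X \<odot>\<^bsub>C\<^esub> e) = \<rho>\<^bsub>C\<^esub> X"

definition left_monoid_action ::
  "('o, 'm, 'b) monoidal_category_scheme \<Rightarrow> 'o \<Rightarrow> 'm \<Rightarrow> 'm \<Rightarrow> 'o \<Rightarrow> 'm \<Rightarrow> bool" where
  "left_monoid_action C M m e X l \<longleftrightarrow> left_semigroup_action C M m X l \<and>
     l \<cdot>\<^bsub>C\<^esub> (e \<odot>\<^bsub>C\<^esub> \<one>\<^bsub>C\<^esub> X) = \<ll>\<^bsub>C\<^esub> X"

text \<open>
  \<open>\<partial>m\<close> as a map out of \<open>\<partial>M \<otimes> M + M \<otimes> \<partial>M\<close>, and its restrictions \<open>i\<^sub>R\<close>, \<open>i\<^sub>L\<close> to the two summands.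
\<close>

definition derived_mult ::
  "('o, 'm, 'b) two_rig_scheme \<Rightarrow> ('o, 'm, 'd) derivation_scheme \<Rightarrow> 'o \<Rightarrow> 'm \<Rightarrow> 'm" where
  "derived_mult R D M m = DAr D m \<cdot>\<^bsub>R\<^esub> leibnizator R D M M"

definition i_R ::
  "('o, 'm, 'b) two_rig_scheme \<Rightarrow> ('o, 'm, 'd) derivation_scheme \<Rightarrow> 'o \<Rightarrow> 'm \<Rightarrow> 'm" where
  "i_R R D M m = derived_mult R D M m \<cdot>\<^bsub>R\<^esub> \<iota>\<^sub>1\<^bsub>R\<^esub> (DOb D M \<otimes>\<^bsub>R\<^esub> M) (M \<otimes>\<^bsub>R\<^esub> DOb D M)"

definition i_L ::
  "('o, 'm, 'b) two_rig_scheme \<Rightarrow> ('o, 'm, 'd) derivation_scheme \<Rightarrow> 'o \<Rightarrow> 'm \<Rightarrow> 'm" where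
  "i_L R D M m = derived_mult R D M m \<cdot>\<^bsub>R\<^esub> \<iota>\<^sub>2\<^bsub>R\<^esub> (DOb D M \<otimes>\<^bsub>R\<^esub> M) (M \<otimes>\<^bsub>R\<^esub> DOb D M)"

end

theory Submission
  imports Defs
begin

text \<open>
  By the definition of the leibnizator as a copairing, the two restrictions of \<open>\<partial>m\<close> are
  \<open>i\<^sub>R = \<partial>(m) \<cdot> RStr M M\<close> and \<open>i\<^sub>L = \<partial>(m) \<cdot> LStr M M\<close> (\<open>i_R_eq\<close>, \<open>i_L_eq\<close>); that \<open>\<partial>m\<close> is
  recovered from the pair \<open>(i\<^sub>R, i\<^sub>L)\<close> is the universal property of the coproduct.

  The action laws are the images under \<open>\<partial>\<close> of the semigroup and monoid laws of \<open>M\<close>.  For the right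
  action, naturality of the strength turns \<open>i\<^sub>R \<cdot> (i\<^sub>R \<odot> \<one> M)\<close> into
  \<open>\<partial>(m \<cdot> (m \<odot> \<one> M)) \<cdot> RStr (M \<otimes> M) M \<cdot> (RStr M M \<odot> \<one> M)\<close>.  Associativity of \<open>m\<close> replaces the first
  factor by \<open>\<partial>(m \<cdot> (\<one> M \<odot> m)) \<cdot> \<partial>(\<alpha> M M M)\<close>, the associativity axiom of the strength moves the
  associator to the right end, and naturality again produces \<open>i\<^sub>R \<cdot> (\<one> (\<partial>M) \<odot> m) \<cdot> \<alpha> (\<partial>M) M M\<close>.
  The unit law is the same computation with the unit axiom of the strength, and the left action
  uses the left strength in the same way.
\<close>

section \<open>Categorical preliminaries\<close>

context category
begin

text \<open>
  Composition is associative only on composable arrows, so a commuting square cannot be rewritten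
  freely inside a longer composite; the next two lemmas carry out such rewriting at either end.
\<close>

lemma square_precomp:
  assumes "k \<cdot> h = k' \<cdot> h'" and "f \<in> hom a b"
    and "h \<in> hom b c" "k \<in> hom c d" and "h' \<in> hom b c'" "k' \<in> hom c' d"
  shows "k \<cdot> (h \<cdot> f) = k' \<cdot> (h' \<cdot> f)"
  by (simp only: Comp_assoc[OF assms(2-4), symmetric] Comp_assoc[OF assms(2,5,6), symmetric]
      assms(1))

lemma square_postcomp:
  assumes "h \<cdot> f = h' \<cdot> f'" and "k \<in> hom c d"
    and "f \<in> hom a b" "h \<in> hom b c" and "f' \<in> hom a b'" "h' \<in> hom b' c"
  shows "(k \<cdot> h) \<cdot> f = (k \<cdot> h') \<cdot> f'"
  by (simp only: Comp_assoc[OF assms(3,4,2)] Comp_assoc[OF assms(5,6,2)] assms(1))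

end

context monoidal_category
begin

lemma Tensor_Ob_in_Ob: "a \<in> Ob C \<Longrightarrow> b \<in> Ob C \<Longrightarrow> a \<otimes> b \<in> Ob C"
  using cat_functor.Fo_in_Ob[OF tensor_functor, of "(a, b)"]
  by (simp add: product_category_def)

lemma Tensor_in_hom:
  "f \<in> hom a a' \<Longrightarrow> g \<in> hom b b' \<Longrightarrow> f \<odot> g \<in> hom (a \<otimes> b) (a' \<otimes> b')"
  using cat_functor.Fm_in_hom[OF tensor_functor, of "(f, g)" "(a, b)" "(a', b')"]
  by (simp add: product_category_def hom_def)

lemma Tensor_Comp:
  assumes "f \<in> hom a b" "f' \<in> hom b c" "g \<in> hom a' b'" "g' \<in> hom b' c'"
  shows "(f' \<cdot> f) \<odot> (g' \<cdot> g) = (f' \<odot> g') \<cdot> (f \<odot> g)"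
  using assms cat_functor.Fm_Comp[OF tensor_functor,
      of "(f, g)" "(a, a')" "(b, b')" "(f', g')" "(c, c')"]
  by (simp add: product_category_def hom_def)

lemma Tensor_Comp_Id_right:
  assumes "f \<in> hom a b" "g \<in> hom b c" "x \<in> Ob C"
  shows "(g \<cdot> f) \<odot> \<one> x = (g \<odot> \<one> x) \<cdot> (f \<odot> \<one> x)"
  using Tensor_Comp[OF assms(1,2) Id_in_hom Id_in_hom, OF assms(3,3)]
    Id_left[OF Id_in_hom[OF assms(3)]] by simp

lemma Tensor_Comp_Id_left:
  assumes "f \<in> hom a b" "g \<in> hom b c" "x \<in> Ob C"
  shows "\<one> x \<odot> (g \<cdot> f) = (\<one> x \<odot> g) \<cdot> (\<one> x \<odot> f)"
  using Tensor_Comp[OF Id_in_hom Id_in_hom assms(1,2), OF assms(3,3)]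
    Id_left[OF Id_in_hom[OF assms(3)]] by simp

end

context two_rig
begin

lemma copair_is_mediating:
  assumes f: "f \<in> hom a x" and g: "g \<in> hom b x"
  shows "copair R f g \<in> hom (a \<oplus> b) x \<and>
    copair R f g \<cdot> \<iota>\<^sub>1 a b = f \<and> copair R f g \<cdot> \<iota>\<^sub>2 a b = g"
proof -
  have d: "Dom R f = a" "Dom R g = b" "Cod R f = x" and ab: "a \<in> Ob R" "b \<in> Ob R"
    using f g Dom_in_Ob by (auto simp: hom_def)
  have "\<exists>!h. h \<in> hom (a \<oplus> b) x \<and> h \<cdot> \<iota>\<^sub>1 a b = f \<and> h \<cdot> \<iota>\<^sub>2 a b = g"
    using Sum_coproduct[OF ab] f g unfolding is_coproduct_def by blast
  from theI'[OF this] show ?thesis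
    unfolding copair_def d .
qed

lemmas copair_in_hom = copair_is_mediating[THEN conjunct1]
lemmas copair_Inl = copair_is_mediating[THEN conjunct2, THEN conjunct1]
lemmas copair_Inr = copair_is_mediating[THEN conjunct2, THEN conjunct2]

lemma Inl_in_hom: "a \<in> Ob R \<Longrightarrow> b \<in> Ob R \<Longrightarrow> \<iota>\<^sub>1 a b \<in> hom a (a \<oplus> b)"
  and Inr_in_hom: "a \<in> Ob R \<Longrightarrow> b \<in> Ob R \<Longrightarrow> \<iota>\<^sub>2 a b \<in> hom b (a \<oplus> b)"
  using Sum_coproduct unfolding is_coproduct_def by blast+

lemma copair_eta:
  assumes h: "h \<in> hom (a \<oplus> b) x" and ab: "a \<in> Ob R" "b \<in> Ob R"
  shows "h = copair R (h \<cdot> \<iota>\<^sub>1 a b) (h \<cdot> \<iota>\<^sub>2 a b)"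
proof -
  have f: "h \<cdot> \<iota>\<^sub>1 a b \<in> hom a x" and g: "h \<cdot> \<iota>\<^sub>2 a b \<in> hom b x"
    by (rule Comp_in_hom[OF Inl_in_hom[OF ab] h], rule Comp_in_hom[OF Inr_in_hom[OF ab] h])
  have "\<exists>!k. k \<in> hom (a \<oplus> b) x \<and> k \<cdot> \<iota>\<^sub>1 a b = h \<cdot> \<iota>\<^sub>1 a b \<and> k \<cdot> \<iota>\<^sub>2 a b = h \<cdot> \<iota>\<^sub>2 a b"
    using Sum_coproduct[OF ab] f g unfolding is_coproduct_def by blast
  then show ?thesis
    using h copair_is_mediating[OF f g] by blast
qed

end


section \<open>The two restrictions of the derived multiplication\<close>

context derivation
begin

lemma leibnizator_in_hom:
  assumes "c \<in> Ob R" "c' \<in> Ob R"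
  shows "leibnizator R D c c' \<in> hom ((DOb D c \<otimes> c') \<oplus> (c \<otimes> DOb D c')) (DOb D (c \<otimes> c'))"
  unfolding leibnizator_def
  by (rule copair_in_hom[OF RStr_in_hom[OF assms] LStr_in_hom[OF assms]])

context
  fixes M m
  assumes M: "M \<in> Ob R" and m: "m \<in> hom (M \<otimes> M) M"
begin

lemma derived_mult_in_hom:
  "derived_mult R D M m \<in> hom ((DOb D M \<otimes> M) \<oplus> (M \<otimes> DOb D M)) (DOb D M)"
  unfolding derived_mult_def
  by (rule Comp_in_hom[OF leibnizator_in_hom[OF M M] Fm_in_hom[OF m]])

lemma derived_mult_eq_copair:
  "derived_mult R D M m = copair R (i_R R D M m) (i_L R D M m)"
  unfolding i_R_def i_L_def
  by (rule copair_eta[OF derived_mult_in_hom]) (intro Tensor_Ob_in_Ob Fo_in_Ob M)+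

lemma i_R_eq: "i_R R D M m = DAr D m \<cdot> RStr D M M"
proof -
  have "i_R R D M m =
      DAr D m \<cdot> (leibnizator R D M M \<cdot> \<iota>\<^sub>1 (DOb D M \<otimes> M) (M \<otimes> DOb D M))"
    unfolding i_R_def derived_mult_def
    by (rule Comp_assoc[OF Inl_in_hom leibnizator_in_hom Fm_in_hom[OF m]])
      (intro Tensor_Ob_in_Ob Fo_in_Ob M)+
  then show ?thesis
    unfolding leibnizator_def copair_Inl[OF RStr_in_hom[OF M M] LStr_in_hom[OF M M]] .
qed

lemma i_L_eq: "i_L R D M m = DAr D m \<cdot> LStr D M M"
proof -
  have "i_L R D M m =
      DAr D m \<cdot> (leibnizator R D M M \<cdot> \<iota>\<^sub>2 (DOb D M \<otimes> M) (M \<otimes> DOb D M))"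
    unfolding i_L_def derived_mult_def
    by (rule Comp_assoc[OF Inr_in_hom leibnizator_in_hom Fm_in_hom[OF m]])
      (intro Tensor_Ob_in_Ob Fo_in_Ob M)+
  then show ?thesis
    unfolding leibnizator_def copair_Inr[OF RStr_in_hom[OF M M] LStr_in_hom[OF M M]] .
qed

text \<open>
  All uses of naturality of the strengths go through the next two lemmas.  They turn each composite
  with an action into \<open>\<partial>\<close> of the corresponding composite with \<open>m\<close>, preceded by a strength, so that
  the laws of \<open>M\<close> apply under \<open>\<partial>\<close> and only the strengths remain to be compared.
\<close>

lemma i_R_comp_tensor:
  assumes g: "g \<in> hom c M" and f: "f \<in> hom a M"
  shows "i_R R D M m \<cdot> (DAr D g \<odot> f) = DAr D (m \<cdot> (g \<odot> f)) \<cdot> RStr D c a"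
proof -
  have c: "c \<in> Ob R" and a: "a \<in> Ob R"
    using g f Dom_in_Ob by (auto simp: hom_def)
  note gf = Tensor_in_hom[OF g f]
  have "i_R R D M m \<cdot> (DAr D g \<odot> f) = (DAr D m \<cdot> DAr D (g \<odot> f)) \<cdot> RStr D c a"
    unfolding i_R_eq
    by (rule square_postcomp[OF RStr_natural[OF g f, symmetric] Fm_in_hom[OF m]
          Tensor_in_hom[OF Fm_in_hom[OF g] f] RStr_in_hom[OF M M]
          RStr_in_hom[OF c a] Fm_in_hom[OF gf]])
  then show ?thesis
    by (simp only: Fm_Comp[OF gf m])
qed

lemma i_L_comp_tensor:
  assumes f: "f \<in> hom a M" and g: "g \<in> hom c M"
  shows "i_L R D M m \<cdot> (f \<odot> DAr D g) = DAr D (m \<cdot> (f \<odot> g)) \<cdot> LStr D a c"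
proof -
  have c: "c \<in> Ob R" and a: "a \<in> Ob R"
    using g f Dom_in_Ob by (auto simp: hom_def)
  note fg = Tensor_in_hom[OF f g]
  have "i_L R D M m \<cdot> (f \<odot> DAr D g) = (DAr D m \<cdot> DAr D (f \<odot> g)) \<cdot> LStr D a c"
    unfolding i_L_eq
    by (rule square_postcomp[OF LStr_natural[OF f g, symmetric] Fm_in_hom[OF m]
          Tensor_in_hom[OF f Fm_in_hom[OF g]] LStr_in_hom[OF M M]
          LStr_in_hom[OF a c] Fm_in_hom[OF fg]])
  then show ?thesis
    by (simp only: Fm_Comp[OF fg m])
qed

end


section \<open>The action laws\<close>

lemma i_R_right_semigroup_action:
  assumes S: "internal_semigroup R M m"
  shows "right_semigroup_action R M m (DOb D M) (i_R R D M m)"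
proof -
  have M: "M \<in> Ob R" and m: "m \<in> hom (M \<otimes> M) M"
    and assoc: "m \<cdot> (m \<odot> \<one> M) = m \<cdot> (\<one> M \<odot> m) \<cdot> \<alpha> M M M"
    using S by (auto simp: internal_semigroup_def)
  let ?X = "DOb D M" and ?r = "i_R R D M m"
  have X: "?X \<in> Ob R" using M by (rule Fo_in_Ob)
  note MM = Tensor_Ob_in_Ob[OF M M]
  note idM = Id_in_hom[OF M]
  note Dm = Fm_in_hom[OF m]
  note str = RStr_in_hom[OF M M]
  have r: "?r \<in> hom (?X \<otimes> M) ?X"
    unfolding i_R_eq[OF M m] by (rule Comp_in_hom[OF str Dm])
  note str1 = Tensor_in_hom[OF str idM] and str2 = RStr_in_hom[OF MM M]
  note mid = Tensor_in_hom[OF m idM] and idm = Tensor_in_hom[OF idM m]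
  note mm = Comp_in_hom[OF idm m]
  note al = Assoc_in_hom[OF M M M] and alX = Assoc_in_hom[OF X M M]
  note Dm1 = Tensor_in_hom[OF Dm idM]
  note str3 = Comp_in_hom[OF str1 str2]
  have "?r \<cdot> (?r \<odot> \<one> M) = ?r \<cdot> ((DAr D m \<odot> \<one> M) \<cdot> (RStr D M M \<odot> \<one> M))"
    using Tensor_Comp_Id_right[OF str Dm M] by (simp only: i_R_eq[OF M m])
  also have "\<dots> = DAr D (m \<cdot> (m \<odot> \<one> M)) \<cdot> (RStr D (M \<otimes> M) M \<cdot> (RStr D M M \<odot> \<one> M))"
    by (rule square_precomp[OF i_R_comp_tensor[OF M m m idM]
          str1 Dm1 r str2 Fm_in_hom[OF Comp_in_hom[OF mid m]]])
  also have "DAr D (m \<cdot> (m \<odot> \<one> M)) = DAr D ((m \<cdot> (\<one> M \<odot> m)) \<cdot> \<alpha> M M M)"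
    by (simp only: assoc Comp_assoc[OF al idm m])
  also have "\<dots> = DAr D (m \<cdot> (\<one> M \<odot> m)) \<cdot> DAr D (\<alpha> M M M)"
    by (rule Fm_Comp[OF al mm])
  also have "\<dots> \<cdot> (RStr D (M \<otimes> M) M \<cdot> (RStr D M M \<odot> \<one> M)) =
      DAr D (m \<cdot> (\<one> M \<odot> m)) \<cdot> (DAr D (\<alpha> M M M) \<cdot> RStr D (M \<otimes> M) M \<cdot> (RStr D M M \<odot> \<one> M))"
    by (rule Comp_assoc[OF str3 Fm_in_hom[OF al] Fm_in_hom[OF mm]])
  also have "\<dots> = DAr D (m \<cdot> (\<one> M \<odot> m)) \<cdot> (RStr D M (M \<otimes> M) \<cdot> \<alpha> ?X M M)"
    by (simp only: RStr_assoc[OF M M M])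
  also have "\<dots> = ?r \<cdot> ((\<one> ?X \<odot> m) \<cdot> \<alpha> ?X M M)"
    by (rule square_precomp[OF i_R_comp_tensor[OF M m idM m, symmetric,
            unfolded Fm_Id[OF M]] alX RStr_in_hom[OF M MM] Fm_in_hom[OF mm]
          Tensor_in_hom[OF Id_in_hom[OF X] m] r])
  finally show ?thesis
    using X r by (simp add: right_semigroup_action_def)
qed

text \<open>
  The roles of the two sides are exchanged with respect to the right action: the inner copy of
  \<open>i\<^sub>L\<close> stands on the side with the associator, so the factor \<open>\<one> M \<odot> LStr M M\<close> that it needs is
  produced by the associativity axiom of the strength, where \<open>RStr M M \<odot> \<one> M\<close> was absorbed by it.
\<close>

lemma i_L_left_semigroup_action:
  assumes S: "internal_semigroup R M m"
  shows "left_semigroup_action R M m (DOb D M) (i_L R D M m)"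
proof -
  have M: "M \<in> Ob R" and m: "m \<in> hom (M \<otimes> M) M"
    and assoc: "m \<cdot> (m \<odot> \<one> M) = m \<cdot> (\<one> M \<odot> m) \<cdot> \<alpha> M M M"
    using S by (auto simp: internal_semigroup_def)
  let ?X = "DOb D M" and ?l = "i_L R D M m"
  have X: "?X \<in> Ob R" using M by (rule Fo_in_Ob)
  note MM = Tensor_Ob_in_Ob[OF M M]
  note idM = Id_in_hom[OF M]
  note Dm = Fm_in_hom[OF m]
  note str = LStr_in_hom[OF M M]
  have l: "?l \<in> hom (M \<otimes> ?X) ?X"
    unfolding i_L_eq[OF M m] by (rule Comp_in_hom[OF str Dm])
  note idm = Tensor_in_hom[OF idM m] and str1 = Tensor_in_hom[OF idM str]
  note mm = Comp_in_hom[OF idm m]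
  note al = Assoc_in_hom[OF M M M] and alX = Assoc_in_hom[OF M M X]
  note Dm1 = Tensor_in_hom[OF idM Dm]
  have "?l \<cdot> (m \<odot> \<one> ?X) = DAr D (m \<cdot> (m \<odot> \<one> M)) \<cdot> LStr D (M \<otimes> M) M"
    using i_L_comp_tensor[OF M m m idM] by (simp only: Fm_Id[OF M])
  also have "DAr D (m \<cdot> (m \<odot> \<one> M)) = DAr D ((m \<cdot> (\<one> M \<odot> m)) \<cdot> \<alpha> M M M)"
    by (simp only: assoc Comp_assoc[OF al idm m])
  also have "\<dots> = DAr D (m \<cdot> (\<one> M \<odot> m)) \<cdot> DAr D (\<alpha> M M M)"
    by (rule Fm_Comp[OF al mm])
  also have "\<dots> \<cdot> LStr D (M \<otimes> M) M =
      DAr D (m \<cdot> (\<one> M \<odot> m)) \<cdot> (DAr D (\<alpha> M M M) \<cdot> LStr D (M \<otimes> M) M)"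
    by (rule Comp_assoc[OF LStr_in_hom[OF MM M] Fm_in_hom[OF al] Fm_in_hom[OF mm]])
  also have "\<dots> = DAr D (m \<cdot> (\<one> M \<odot> m)) \<cdot>
      (LStr D M (M \<otimes> M) \<cdot> ((\<one> M \<odot> LStr D M M) \<cdot> \<alpha> M M ?X))"
    by (simp only: LStr_assoc[OF M M M])
  also have "\<dots> = ?l \<cdot> ((\<one> M \<odot> DAr D m) \<cdot> ((\<one> M \<odot> LStr D M M) \<cdot> \<alpha> M M ?X))"
    by (rule square_precomp[OF i_L_comp_tensor[OF M m idM m, symmetric]
          Comp_in_hom[OF alX str1] LStr_in_hom[OF M MM] Fm_in_hom[OF mm] Dm1 l])
  also have "\<dots> = ?l \<cdot> ((\<one> M \<odot> DAr D m) \<cdot> (\<one> M \<odot> LStr D M M)) \<cdot> \<alpha> M M ?X"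
    by (simp only: Comp_assoc[OF alX str1 Dm1])
  also have "\<dots> = ?l \<cdot> (\<one> M \<odot> ?l) \<cdot> \<alpha> M M ?X"
    using Tensor_Comp_Id_left[OF str Dm M] by (simp only: i_L_eq[OF M m])
  finally show ?thesis
    using X l by (simp add: left_semigroup_action_def)
qed

lemma i_R_right_monoid_action:
  assumes S: "internal_monoid R M m e"
  shows "right_monoid_action R M m e (DOb D M) (i_R R D M m)"
proof -
  have sg: "internal_semigroup R M m" and M: "M \<in> Ob R" and m: "m \<in> hom (M \<otimes> M) M"
    and e: "e \<in> hom \<I> M" and unit: "m \<cdot> (\<one> M \<odot> e) = \<rho> M"
    using S by (auto simp: internal_monoid_def internal_semigroup_def)
  have "i_R R D M m \<cdot> (\<one> (DOb D M) \<odot> e) = DAr D (\<rho> M) \<cdot> RStr D M \<I>"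
    using i_R_comp_tensor[OF M m Id_in_hom[OF M] e] by (simp only: Fm_Id[OF M] unit)
  also have "\<dots> = \<rho> (DOb D M)" by (rule RStr_unit[OF M])
  finally show ?thesis
    using i_R_right_semigroup_action[OF sg] by (simp add: right_monoid_action_def)
qed

lemma i_L_left_monoid_action:
  assumes S: "internal_monoid R M m e"
  shows "left_monoid_action R M m e (DOb D M) (i_L R D M m)"
proof -
  have sg: "internal_semigroup R M m" and M: "M \<in> Ob R" and m: "m \<in> hom (M \<otimes> M) M"
    and e: "e \<in> hom \<I> M" and unit: "m \<cdot> (e \<odot> \<one> M) = \<ll> M"
    using S by (auto simp: internal_monoid_def internal_semigroup_def)
  have "i_L R D M m \<cdot> (e \<odot> \<one> (DOb D M)) = DAr D (\<ll> M) \<cdot> LStr D \<I> M"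
    using i_L_comp_tensor[OF M m e Id_in_hom[OF M]] by (simp only: Fm_Id[OF M] unit)
  also have "\<dots> = \<ll> (DOb D M)" by (rule LStr_unit[OF M])
  finally show ?thesis
    using i_L_left_semigroup_action[OF sg] by (simp add: left_monoid_action_def)
qed

end

theorem proposition4p13:
  fixes R :: "('o, 'm) two_rig"
    and D :: "('o, 'm) derivation"
  assumes "two_rig R"
    and "derivation R D"
  shows "(\<forall>M m. internal_semigroup R M m \<longrightarrow>
            derived_mult R D M m \<in> hom\<^bsub>R\<^esub> ((DOb D M \<otimes>\<^bsub>R\<^esub> M) \<oplus>\<^bsub>R\<^esub> (M \<otimes>\<^bsub>R\<^esub> DOb D M)) (DOb D M) \<and>
            derived_mult R D M m = copair R (i_R R D M m) (i_L R D M m) \<and>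
            right_semigroup_action R M m (DOb D M) (i_R R D M m) \<and>
            left_semigroup_action R M m (DOb D M) (i_L R D M m)) \<and>
         (\<forall>M m e. internal_monoid R M m e \<longrightarrow>
            derived_mult R D M m \<in> hom\<^bsub>R\<^esub> ((DOb D M \<otimes>\<^bsub>R\<^esub> M) \<oplus>\<^bsub>R\<^esub> (M \<otimes>\<^bsub>R\<^esub> DOb D M)) (DOb D M) \<and>
            derived_mult R D M m = copair R (i_R R D M m) (i_L R D M m) \<and>
            right_monoid_action R M m e (DOb D M) (i_R R D M m) \<and>
            left_monoid_action R M m e (DOb D M) (i_L R D M m))"
proof -
  interpret derivation R D by fact
  show ?thesis
  proof (intro conjI allI impI)
    fix M m assume S: "internal_semigroup R M m"
    then have Mm: "M \<in> Ob R" "m \<in> hom\<^bsub>R\<^esub> (M \<otimes>\<^bsub>R\<^esub> M) M"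
      by (simp_all add: internal_semigroup_def)
    show "derived_mult R D M m \<in> hom\<^bsub>R\<^esub> ((DOb D M \<otimes>\<^bsub>R\<^esub> M) \<oplus>\<^bsub>R\<^esub> (M \<otimes>\<^bsub>R\<^esub> DOb D M)) (DOb D M)"
      by (rule derived_mult_in_hom[OF Mm])
    show "derived_mult R D M m = copair R (i_R R D M m) (i_L R D M m)"
      by (rule derived_mult_eq_copair[OF Mm])
    show "right_semigroup_action R M m (DOb D M) (i_R R D M m)"
      by (rule i_R_right_semigroup_action[OF S])
    show "left_semigroup_action R M m (DOb D M) (i_L R D M m)"
      by (rule i_L_left_semigroup_action[OF S])
  next
    fix M m e assume S: "internal_monoid R M m e"
    then have Mm: "M \<in> Ob R" "m \<in> hom\<^bsub>R\<^esub> (M \<otimes>\<^bsub>R\<^esub> M) M"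
      by (simp_all add: internal_monoid_def internal_semigroup_def)
    show "derived_mult R D M m \<in> hom\<^bsub>R\<^esub> ((DOb D M \<otimes>\<^bsub>R\<^esub> M) \<oplus>\<^bsub>R\<^esub> (M \<otimes>\<^bsub>R\<^esub> DOb D M)) (DOb D M)"
      by (rule derived_mult_in_hom[OF Mm])
    show "derived_mult R D M m = copair R (i_R R D M m) (i_L R D M m)"
      by (rule derived_mult_eq_copair[OF Mm])
    show "right_monoid_action R M m e (DOb D M) (i_R R D M m)"
      by (rule i_R_right_monoid_action[OF S])
    show "left_monoid_action R M m e (DOb D M) (i_L R D M m)"
      by (rule i_L_left_monoid_action[OF S])
  qed
qed

end
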